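(* Let $f:\mathbb{R}^n\to\mathbb{R}$ be of class $C^2$, convex, $L$-smooth and bounded below, with $f^\star:=\inf f$ and $\phi(x_1):=f(x_1)-f^\star$. Let $m\ge 0$, let $q:\mathbb{R}^n\times\mathbb{R}^m\to\mathbb{R}^m$ be locally Lipschitz, and consider the system with state $(x_1,x_2,z)\in\mathbb{R}^n\times\mathbb{R}^n\times\mathbb{R}^m$ and input $u\in\mathbb{R}^n$ $$\dot x_1=x_2,\qquad \dot x_2=u,\qquad \dot z=q(x_1,z)$$ (for $m=0$ there is no $z$ and all $z$-dependence is suppressed). Let $\alpha:\mathbb{R}^n\times\mathbb{R}^m\to\mathbb{R}^n$ be continuously differentiable and put $e:=x_2-\alpha(x_1,z)$. Assume: (1) There exist a continuously differentiable function $V_1:\mathbb{R}^n\times\mathbb{R}^m\to\mathbb{R}$ and constants $c_\phi,c_z,\sigma,\lambda>0$ such that $V_1(x_1,z)\ge c_\phi\phi(x_1)+c_z\|z\|^2$ for all $(x_1,z)$, and such that along $\dot x_1=\alpha(x_1,z)+e$, $\dot z=q(x_1,z)$ one has $\dot V_1=-\sigma\|\nabla f(x_1)\|^2+\lambda\nabla f(x_1)^\top e$, i.e. for all $(x_1,z,e)$ $$\nabla_{x_1}V_1(x_1,z)^\top(\alpha(x_1,z)+e)+\nabla_zV_1(x_1,z)^\top q(x_1,z)=-\sigma\|\nabla f(x_1)\|^2+\lambda\nabla f(x_1)^\top e .$$ (2) If $(\nabla f(x_1),z)$ is bounded, then so is $\alpha(x_1,z)$; that is, for every $R>0$ the function $\alpha$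 is bounded on $\{(x_1,z):\|\nabla f(x_1)\|\le R,\ \|z\|\le R\}$. Let $c>0$ and choose the feedback $$u=\dot\alpha-c\,e-\lambda\nabla f(x_1),$$ where $\dot\alpha=\frac{\partial\alpha}{\partial x_1}(x_1,z)\,x_2+\frac{\partial\alpha}{\partial z}(x_1,z)\,q(x_1,z)$ is the total derivative of $\alpha$ along the system. Then, with $V:=V_1(x_1,z)+\frac12\|e\|^2$, the closed-loop system satisfies $$\dot V=-\sigma\|\nabla f(x_1)\|^2-c\|e\|^2$$ and consequently, along every closed-loop trajectory on $[0,\infty)$, $\nabla f(x_1(t))\to 0$ as $t\to\infty$.
   Context: $\|\cdot\|$ is the Euclidean norm (or the induced operator norm). $L$-smooth means $\|\nabla f(x)-\nabla f(y)\|\le L\|x-y\|$ for all $x,y\in\mathbb{R}^n$. $\dot V$ denotes the time derivative along trajectories. *)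

theory Defs
  imports "HOL-Analysis.Analysis"
begin

definition continuously_differentiable ::
  "('a::real_normed_vector \<Rightarrow> 'b::real_normed_vector) \<Rightarrow> bool" where
  "continuously_differentiable F \<longleftrightarrow>
     (\<exists>F' :: 'a \<Rightarrow> 'a \<Rightarrow>\<^sub>L 'b.
        (\<forall>x. (F has_derivative blinfun_apply (F' x)) (at x)) \<and> continuous_on UNIV F')"

definition twice_continuously_differentiable ::
  "('a::real_normed_vector \<Rightarrow> 'b::real_normed_vector) \<Rightarrow> bool" where
  "twice_continuously_differentiable F \<longleftrightarrow>
     (\<exists>F' :: 'a \<Rightarrow> 'a \<Rightarrow>\<^sub>L 'b.
        (\<forall>x. (F has_derivative blinfun_apply (F' x)) (at x)) \<and> continuously_differentiable F')"

text \<open>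
  The value of \<open>grad f x\<close> is unspecified where \<open>f\<close> is not differentiable; below it is only used
  for (partial applications of) continuously differentiable functions.
\<close>

definition grad :: "('a::real_inner \<Rightarrow> real) \<Rightarrow> 'a \<Rightarrow> 'a" where
  "grad f x = (THE D. GDERIV f x :> D)"

definition smooth_with :: "real \<Rightarrow> ('a::real_inner \<Rightarrow> real) \<Rightarrow> bool" where
  "smooth_with L f \<longleftrightarrow> (\<forall>x y. norm (grad f x - grad f y) \<le> L * norm (x - y))"

definition gap :: "('a \<Rightarrow> real) \<Rightarrow> 'a \<Rightarrow> real" where
  "gap f x = f x - (INF y. f y)"

text \<open>
  The library notion of local Lipschitz continuity is for time-dependent maps; an autonomous map
  is regarded as constant in time.
\<close>

definition locally_lipschitz :: "('a::metric_space \<Rightarrow> 'b::metric_space) \<Rightarrow> bool" where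
  "locally_lipschitz q \<longleftrightarrow> local_lipschitz (UNIV :: real set) UNIV (\<lambda>_. q)"

definition solution_on ::
  "real set \<Rightarrow> ('s::real_normed_vector \<Rightarrow> 's) \<Rightarrow> (real \<Rightarrow> 's) \<Rightarrow> bool" where
  "solution_on J F s \<longleftrightarrow> (\<forall>t\<in>J. (s has_vector_derivative F (s t)) (at t within J))"

definition alpha_dot ::
  "('a::real_normed_vector \<times> 'z::real_normed_vector \<Rightarrow> 'a) \<Rightarrow> ('a \<times> 'z \<Rightarrow> 'z) \<Rightarrow> 'a \<times> 'a \<times> 'z \<Rightarrow> 'a" where
  "alpha_dot \<alpha> q = (\<lambda>(x1, x2, z).
     frechet_derivative (\<lambda>x. \<alpha> (x, z)) (at x1) x2 +
     frechet_derivative (\<lambda>w. \<alpha> (x1, w)) (at z) (q (x1, z)))"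

definition error ::
  "('a::real_normed_vector \<times> 'z \<Rightarrow> 'a) \<Rightarrow> 'a \<times> 'a \<times> 'z \<Rightarrow> 'a" where
  "error \<alpha> = (\<lambda>(x1, x2, z). x2 - \<alpha> (x1, z))"

definition feedback ::
  "('a::real_inner \<Rightarrow> real) \<Rightarrow> ('a \<times> 'z::real_normed_vector \<Rightarrow> 'z) \<Rightarrow> ('a \<times> 'z \<Rightarrow> 'a) \<Rightarrow>
     real \<Rightarrow> real \<Rightarrow> 'a \<times> 'a \<times> 'z \<Rightarrow> 'a" where
  "feedback f q \<alpha> lam c = (\<lambda>(x1, x2, z).
     alpha_dot \<alpha> q (x1, x2, z) - c *\<^sub>R error \<alpha> (x1, x2, z) - lam *\<^sub>R grad f x1)"

definition closed_loop ::
  "('a::real_inner \<Rightarrow> real) \<Rightarrow> ('a \<times> 'z::real_normed_vector \<Rightarrow> 'z) \<Rightarrow> ('a \<times> 'z \<Rightarrow> 'a) \<Rightarrow>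
     real \<Rightarrow> real \<Rightarrow> 'a \<times> 'a \<times> 'z \<Rightarrow> 'a \<times> 'a \<times> 'z" where
  "closed_loop f q \<alpha> lam c = (\<lambda>(x1, x2, z).
     (x2, feedback f q \<alpha> lam c (x1, x2, z), q (x1, z)))"

definition composite_V ::
  "('a::real_normed_vector \<times> 'z \<Rightarrow> real) \<Rightarrow> ('a \<times> 'z \<Rightarrow> 'a) \<Rightarrow> 'a \<times> 'a \<times> 'z \<Rightarrow> real" where
  "composite_V V1 \<alpha> = (\<lambda>(x1, x2, z). V1 (x1, z) + (norm (error \<alpha> (x1, x2, z)))\<^sup>2 / 2)"

text \<open>
  A type \<open>real ^ 'm\<close> has positive dimension, so the case of no \<open>z\<close>-component needs
  separate versions of these constants.
\<close>

definition error0 :: "('a::real_normed_vector \<Rightarrow> 'a) \<Rightarrow> 'a \<times> 'a \<Rightarrow> 'a" where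
  "error0 \<alpha> = (\<lambda>(x1, x2). x2 - \<alpha> x1)"

definition feedback0 ::
  "('a::real_inner \<Rightarrow> real) \<Rightarrow> ('a \<Rightarrow> 'a) \<Rightarrow> real \<Rightarrow> real \<Rightarrow> 'a \<times> 'a \<Rightarrow> 'a" where
  "feedback0 f \<alpha> lam c = (\<lambda>(x1, x2).
     frechet_derivative \<alpha> (at x1) x2 - c *\<^sub>R error0 \<alpha> (x1, x2) - lam *\<^sub>R grad f x1)"

definition closed_loop0 ::
  "('a::real_inner \<Rightarrow> real) \<Rightarrow> ('a \<Rightarrow> 'a) \<Rightarrow> real \<Rightarrow> real \<Rightarrow> 'a \<times> 'a \<Rightarrow> 'a \<times> 'a" where
  "closed_loop0 f \<alpha> lam c = (\<lambda>(x1, x2). (x2, feedback0 f \<alpha> lam c (x1, x2)))"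

definition composite_V0 ::
  "('a::real_normed_vector \<Rightarrow> real) \<Rightarrow> ('a \<Rightarrow> 'a) \<Rightarrow> 'a \<times> 'a \<Rightarrow> real" where
  "composite_V0 V1 \<alpha> = (\<lambda>(x1, x2). V1 x1 + (norm (error0 \<alpha> (x1, x2)))\<^sup>2 / 2)"

text \<open>
  The derivative of \<open>V\<close> along \<open>s' = F s\<close> equals \<open>W\<close>: both pointwise on the state space, as the
  derivative of \<open>V\<close> in direction \<open>F\<close>, and as the time derivative along every solution on an
  interval (one-sided at an end point belonging to the interval).
\<close>

definition derivative_along ::
  "('s::real_normed_vector \<Rightarrow> real) \<Rightarrow> ('s \<Rightarrow> 's) \<Rightarrow> ('s \<Rightarrow> real) \<Rightarrow> bool" where
  "derivative_along V F W \<longleftrightarrow>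
     (\<forall>p. \<exists>V'. (V has_derivative V') (at p) \<and> V' (F p) = W p) \<and>
     (\<forall>J s. is_interval J \<longrightarrow> solution_on J F s \<longrightarrow>
        (\<forall>t\<in>J. ((\<lambda>\<tau>. V (s \<tau>)) has_real_derivative W (s t)) (at t within J)))"

end

theory Submission
  imports Defs
begin

text \<open>
  The feedback is built so that the input cancels \<open>\<alpha>\<close>'s own motion, adds damping to the error
  \<open>e\<close>, and contributes \<open>- lam (grad f x1 \<bullet> e)\<close> to the derivative of \<open>\<parallel>e\<parallel>\<^sup>2 / 2\<close>, which is exactly the
  cross term, with opposite sign, that the error injects into the derivative of \<open>V1\<close>.  Hence
  \<open>V = V1 + \<parallel>e\<parallel>\<^sup>2 / 2\<close> decays at the rate \<open>\<sigma> \<parallel>grad f x1\<parallel>\<^sup>2 + c \<parallel>e\<parallel>\<^sup>2\<close>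
  (\<open>composite_V_derivative_along\<close>).

  The state \<open>x1\<close> itself may be unbounded, because \<open>f\<close> need not be coercive, so LaSalle-type
  compactness arguments do not apply.  What is bounded is everything that drives \<open>x1\<close>: along a
  trajectory \<open>V\<close> does not increase, so it bounds \<open>gap f x1\<close>, \<open>z\<close> and \<open>e\<close>; a smooth function that is
  bounded below satisfies \<open>\<parallel>grad f x\<parallel>\<^sup>2 \<le> 4 L gap f x\<close> (\<open>grad_bound_by_gap\<close>), so
  \<open>grad f x1\<close> is bounded too; then \<open>\<alpha>\<close> is bounded by the growth hypothesis, and with it the velocity
  \<open>x2 = e + \<alpha>\<close>.  Consequently \<open>t \<mapsto> grad f (x1 t)\<close> is Lipschitz.  A Lipschitz curve whose squared
  norm is paid for by the decrease of a quantity bounded below must tend to zero, a form of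
  Barbalat's lemma (\<open>lipschitz_dissipation_imp_tendsto_zero\<close>).

  The system without \<open>z\<close> is the invariant subspace \<open>z = 0\<close> of a system with a scalar \<open>z\<close> that does
  not move, with \<open>V1\<close> enlarged by \<open>z\<^sup>2\<close>, so the case of no \<open>z\<close> follows by pulling the result back
  along the inclusion.
\<close>

section \<open>Gradients and derivatives along a vector field\<close>

lemma inner_grad_eq_derivative:
  fixes f :: "'a::euclidean_space \<Rightarrow> real"
  assumes "(f has_derivative f') (at x)"
  shows "grad f x \<bullet> h = f' h"
proof -
  interpret linear f' using assms by (rule has_derivative_linear)
  define D where "D = (\<Sum>b\<in>Basis. f' b *\<^sub>R b)"
  have D: "h \<bullet> D = f' h" for h
  proof -
    have "f' h = f' (\<Sum>b\<in>Basis. (h \<bullet> b) *\<^sub>R b)" by (simp add: euclidean_representation)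
    also have "\<dots> = (\<Sum>b\<in>Basis. (h \<bullet> b) * f' b)" by (simp add: sum scale)
    finally show ?thesis by (simp add: D_def inner_sum_right mult.commute)
  qed
  have "GDERIV f x :> D" using assms by (simp add: gderiv_def D)
  moreover have "D' = D" if "GDERIV f x :> D'" for D'
  proof -
    have "(\<lambda>h. h \<bullet> D') = f'"
      using that assms unfolding gderiv_def by (rule has_derivative_unique)
    then have "h \<bullet> D' = h \<bullet> D" for h using D by metis
    then show ?thesis by (metis vector_eq_ldot)
  qed
  ultimately have "grad f x = D" unfolding grad_def by (rule the_equality)
  then show ?thesis using D[of h] by (simp add: inner_commute)
qed

lemma continuously_differentiableE:
  fixes F :: "'a::real_normed_vector \<Rightarrow> 'b::real_normed_vector"
  assumes "continuously_differentiable F"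
  obtains F' where "\<And>x. (F has_derivative F' x) (at x)"
proof -
  obtain F' :: "'a \<Rightarrow> 'a \<Rightarrow>\<^sub>L 'b" where "\<forall>x. (F has_derivative blinfun_apply (F' x)) (at x)"
    using assms unfolding continuously_differentiable_def by blast
  then show thesis using that[of "\<lambda>x. blinfun_apply (F' x)"] by blast
qed

lemma derivative_alongI:
  assumes "\<And>p. \<exists>V'. (V has_derivative V') (at p) \<and> V' (F p) = W p"
  shows "derivative_along V F W"
  unfolding derivative_along_def
proof (intro conjI allI impI ballI)
  fix J s t assume sol: "solution_on J F s" and t: "t \<in> J"
  obtain V' where V': "(V has_derivative V') (at (s t))" "V' (F (s t)) = W (s t)"
    using assms by blast
  have "(s has_vector_derivative F (s t)) (at t within J)"
    using sol t by (auto simp: solution_on_def)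
  then have "(V \<circ> s has_vector_derivative V' (F (s t))) (at t within J)"
    by (rule vector_derivative_diff_chain_within)
      (rule has_derivative_at_withinI[OF V'(1)])
  then show "((\<lambda>\<tau>. V (s \<tau>)) has_real_derivative W (s t)) (at t within J)"
    by (simp add: V'(2) o_def has_real_derivative_iff_has_vector_derivative)
qed (rule assms)

text \<open>
  A linear inclusion that intertwines the two vector fields identifies the smaller system with an
  invariant subspace of the larger one, where rates of change can be computed.
\<close>

lemma derivative_along_pullback:
  assumes "derivative_along V F W" "bounded_linear i" "\<And>p. F (i p) = i (G p)"
  shows "derivative_along (\<lambda>p. V (i p)) G (\<lambda>p. W (i p))"
proof (rule derivative_alongI)
  fix p
  obtain V' where V': "(V has_derivative V') (at (i p))" "V' (F (i p)) = W (i p)"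
    using assms(1) unfolding derivative_along_def by blast
  have "(i has_derivative i) (at p)" using assms(2) by (rule bounded_linear_imp_has_derivative)
  from has_derivative_compose[OF this V'(1)]
  show "\<exists>V''. ((\<lambda>p. V (i p)) has_derivative V'') (at p) \<and> V'' (G p) = W (i p)"
    using V'(2) assms(3) by (intro exI[of _ "\<lambda>h. V' (i h)"]) auto
qed

section \<open>Convergence from dissipation\<close>

text \<open>
  One gradient step of length \<open>1 / (2 * L)\<close> lowers \<open>f\<close> by at least \<open>\<parallel>grad f x\<parallel>\<^sup>2 / (4 * L)\<close>, and
  it cannot go below the infimum.
\<close>

lemma grad_bound_by_gap:
  fixes f :: "'a::euclidean_space \<Rightarrow> real"
  assumes diff: "\<And>x. (f has_derivative f' x) (at x)"
    and smooth: "smooth_with L f" and "L > 0" and bdd: "bdd_below (range f)"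
  shows "(norm (grad f x))\<^sup>2 \<le> 4 * L * gap f x"
proof -
  define g where "g = grad f x"
  define h where "h = 1 / (2 * L)"
  have "h > 0" using \<open>L > 0\<close> by (simp add: h_def)
  have dline: "((\<lambda>t. f (x - t *\<^sub>R g)) has_derivative (\<lambda>r. r * - (grad f (x - t *\<^sub>R g) \<bullet> g)))
      (at t within {0..h})" for t
  proof -
    have "((\<lambda>t. x - t *\<^sub>R g) has_derivative (\<lambda>r. - (r *\<^sub>R g))) (at t within {0..h})"
      by (auto intro!: derivative_eq_intros)
    from has_derivative_compose[OF this diff]
    show ?thesis
      by (rule has_derivative_eq_rhs)
        (auto simp: inner_grad_eq_derivative[OF diff, symmetric])
  qed
  obtain t where t: "t \<in> {0..h}"
    and mvt: "f (x - h *\<^sub>R g) - f (x - 0 *\<^sub>R g) = (h - 0) * - (grad f (x - t *\<^sub>R g) \<bullet> g)"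
    using mvt_very_simple[of 0 h "\<lambda>t. f (x - t *\<^sub>R g)"
        "\<lambda>t r. r * - (grad f (x - t *\<^sub>R g) \<bullet> g)"] dline \<open>h > 0\<close> by auto
  have "norm (grad f x - grad f (x - t *\<^sub>R g)) \<le> L * norm (t *\<^sub>R g)"
    using smooth unfolding smooth_with_def by (metis diff_diff_eq2 add_diff_cancel_left')
  also have "\<dots> \<le> L * (h * norm g)"
    using t \<open>L > 0\<close> by (auto intro!: mult_left_mono mult_right_mono)
  also have "\<dots> = norm g / 2" using \<open>L > 0\<close> by (simp add: h_def)
  finally have near: "norm (g - grad f (x - t *\<^sub>R g)) \<le> norm g / 2" by (simp add: g_def)
  have "(g - grad f (x - t *\<^sub>R g)) \<bullet> g \<le> norm (g - grad f (x - t *\<^sub>R g)) * norm g"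
    by (rule norm_cauchy_schwarz)
  also have "\<dots> \<le> norm g / 2 * norm g" using near by (rule mult_right_mono) simp
  finally have "grad f (x - t *\<^sub>R g) \<bullet> g \<ge> (norm g)\<^sup>2 / 2"
    using power2_norm_eq_inner[of g] by (simp add: inner_diff_left power2_eq_square)
  then have "h * ((norm g)\<^sup>2 / 2) \<le> h * (grad f (x - t *\<^sub>R g) \<bullet> g)"
    using \<open>h > 0\<close> by (intro mult_left_mono) auto
  then have "f (x - h *\<^sub>R g) \<le> f x - h * ((norm g)\<^sup>2 / 2)" using mvt by simp
  moreover have "(INF y. f y) \<le> f (x - h *\<^sub>R g)" using bdd by (intro cINF_lower) auto
  ultimately have "h * ((norm g)\<^sup>2 / 2) \<le> gap f x" by (simp add: gap_def)
  then show ?thesis using \<open>L > 0\<close> by (simp add: h_def g_def field_simps)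
qed

text \<open>
  The total decrease of \<open>W\<close> is finite, so late windows of any fixed length \<open>d\<close> see an arbitrarily
  small decrease; by the mean value theorem some point of the window then has small \<open>g\<close>, and the
  Lipschitz bound carries the smallness from there to the beginning of the window.
\<close>

lemma lipschitz_dissipation_imp_tendsto_zero:
  fixes g :: "real \<Rightarrow> 'a::real_normed_vector" and W W' :: "real \<Rightarrow> real"
  assumes deriv: "\<And>t. t \<ge> 0 \<Longrightarrow> (W has_real_derivative W' t) (at t within {0..})"
    and decay: "\<And>t. t \<ge> 0 \<Longrightarrow> W' t \<le> - \<sigma> * (norm (g t))\<^sup>2" and "\<sigma> > 0"
    and below: "\<And>t. t \<ge> 0 \<Longrightarrow> b \<le> W t"
    and lip: "\<And>s t. s \<ge> 0 \<Longrightarrow> t \<ge> 0 \<Longrightarrow> norm (g s - g t) \<le> K * \<bar>s - t\<bar>" and "K > 0"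
  shows "(g \<longlongrightarrow> 0) at_top"
proof (rule tendstoI)
  fix \<epsilon> :: real assume "\<epsilon> > 0"
  have mvt: "\<exists>\<xi>\<in>{s..t}. \<sigma> * (norm (g \<xi>))\<^sup>2 * (t - s) \<le> W s - W t" if "0 \<le> s" "s \<le> t" for s t
  proof -
    have "\<exists>\<xi>\<in>{s..t}. W t - W s = W' \<xi> * (t - s)"
    proof (rule mvt_very_simple[OF \<open>s \<le> t\<close>])
      fix r assume "s \<le> r" "r \<le> t"
      then have "(W has_real_derivative W' r) (at r within {s..t})"
        using that by (intro DERIV_subset[OF deriv]) auto
      then show "(W has_derivative (*) (W' r)) (at r within {s..t})"
        by (simp add: has_field_derivative_def)
    qed
    then obtain \<xi> where \<xi>: "\<xi> \<in> {s..t}" "W t - W s = W' \<xi> * (t - s)" by blast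
    have "W' \<xi> * (t - s) \<le> - \<sigma> * (norm (g \<xi>))\<^sup>2 * (t - s)"
      using \<xi>(1) that by (intro mult_right_mono decay) auto
    then show ?thesis using \<xi> by (intro bexI[of _ \<xi>]) auto
  qed
  have antimono: "W t \<le> W s" if "0 \<le> s" "s \<le> t" for s t
  proof -
    obtain \<xi> where "\<sigma> * (norm (g \<xi>))\<^sup>2 * (t - s) \<le> W s - W t" using mvt[OF \<open>0 \<le> s\<close> \<open>s \<le> t\<close>] by blast
    moreover have "0 \<le> \<sigma> * (norm (g \<xi>))\<^sup>2 * (t - s)" using that \<open>\<sigma> > 0\<close> by simp
    ultimately show ?thesis by linarith
  qed
  define d where "d = \<epsilon> / (2 * K)"
  define \<eta> where "\<eta> = \<sigma> * (\<epsilon> / 2)\<^sup>2 * d"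
  have "d > 0" "\<eta> > 0" using \<open>\<epsilon> > 0\<close> \<open>K > 0\<close> \<open>\<sigma> > 0\<close> by (simp_all add: d_def \<eta>_def)
  define I where "I = (INF t\<in>{0..}. W t)"
  have bdd: "bdd_below (W ` {0..})" using below by (intro bdd_belowI2[of _ b]) auto
  have "\<exists>y\<in>W ` {0..}. y < I + \<eta>"
    using \<open>\<eta> > 0\<close> unfolding I_def by (intro cInf_lessD) auto
  then obtain T where T: "T \<ge> 0" "W T < I + \<eta>" by auto
  have "dist (g t) 0 < \<epsilon>" if "t \<ge> T" for t
  proof -
    have "t \<ge> 0" using T that by simp
    then obtain \<xi> where \<xi>: "\<xi> \<in> {t..t + d}" "\<sigma> * (norm (g \<xi>))\<^sup>2 * d \<le> W t - W (t + d)"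
      using mvt[of t "t + d"] \<open>d > 0\<close> by auto
    have "I \<le> W (t + d)"
      unfolding I_def using bdd \<open>t \<ge> 0\<close> \<open>d > 0\<close> by (intro cINF_lower) auto
    then have "W t - W (t + d) < \<eta>" using antimono[OF \<open>T \<ge> 0\<close> that] T by linarith
    then have "\<sigma> * (norm (g \<xi>))\<^sup>2 * d < \<sigma> * (\<epsilon> / 2)\<^sup>2 * d" using \<xi>(2) by (simp add: \<eta>_def)
    then have "(norm (g \<xi>))\<^sup>2 < (\<epsilon> / 2)\<^sup>2" using \<open>\<sigma> > 0\<close> \<open>d > 0\<close> by simp
    then have small: "norm (g \<xi>) < \<epsilon> / 2"
      by (rule power2_less_imp_less) (use \<open>\<epsilon> > 0\<close> in simp)
    have "norm (g t - g \<xi>) \<le> K * \<bar>t - \<xi>\<bar>" using \<xi>(1) \<open>t \<ge> 0\<close> by (intro lip) auto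
    also have "\<dots> \<le> K * d" using \<xi>(1) \<open>K > 0\<close> by (intro mult_left_mono) auto
    also have "\<dots> = \<epsilon> / 2" using \<open>K > 0\<close> by (simp add: d_def)
    finally have "norm (g t) < \<epsilon>" using small norm_triangle_sub[of "g t" "g \<xi>"] by linarith
    then show ?thesis by simp
  qed
  then show "\<forall>\<^sub>F t in at_top. dist (g t) 0 < \<epsilon>" by (auto simp: eventually_at_top_linorder)
qed

section \<open>The closed loop\<close>

lemma composite_V_derivative_along:
  fixes f :: "'a::euclidean_space \<Rightarrow> real" and V1 :: "'a \<times> 'z::euclidean_space \<Rightarrow> real"
  assumes A: "\<And>y. (\<alpha> has_derivative A y) (at y)" and B: "\<And>y. (V1 has_derivative B y) (at y)"
    and decay: "\<And>x1 z e. grad (\<lambda>x. V1 (x, z)) x1 \<bullet> (\<alpha> (x1, z) + e)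
        + grad (\<lambda>w. V1 (x1, w)) z \<bullet> q (x1, z)
        = - \<sigma> * (norm (grad f x1))\<^sup>2 + lam * (grad f x1 \<bullet> e)"
  shows "derivative_along (composite_V V1 \<alpha>) (closed_loop f q \<alpha> lam c)
         (\<lambda>(x1, x2, z). - \<sigma> * (norm (grad f x1))\<^sup>2 - c * (norm (error \<alpha> (x1, x2, z)))\<^sup>2)"
proof (rule derivative_alongI)
  fix p :: "'a \<times> 'a \<times> 'z"
  obtain x1 x2 z where p: "p = (x1, x2, z)" by (cases p)
  let ?A = "A (x1, z)" and ?B = "B (x1, z)"
  define e where "e = x2 - \<alpha> (x1, z)"
  define v where "v = closed_loop f q \<alpha> lam c p"
  interpret A: linear ?A using A by (rule has_derivative_linear)
  interpret B: linear ?B using B by (rule has_derivative_linear)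
  have fst: "((\<lambda>x. (x, z)) has_derivative (\<lambda>h. (h, 0))) (at x1)"
    and snd: "((\<lambda>w. (x1, w)) has_derivative (\<lambda>h. (0, h))) (at z)"
    by (auto intro!: derivative_eq_intros)
  have "alpha_dot \<alpha> q p = ?A (x2, 0) + ?A (0, q (x1, z))"
    using frechet_derivative_at[OF has_derivative_compose[OF fst A]]
      frechet_derivative_at[OF has_derivative_compose[OF snd A]]
    by (simp add: alpha_dot_def p) metis
  then have alpha_dot: "alpha_dot \<alpha> q p = ?A (x2, q (x1, z))" by (simp flip: A.add)
  have "?B (x2, 0) + ?B (0, q (x1, z)) = - \<sigma> * (norm (grad f x1))\<^sup>2 + lam * (grad f x1 \<bullet> e)"
    using decay[of z x1 e] inner_grad_eq_derivative[OF has_derivative_compose[OF fst B]]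
      inner_grad_eq_derivative[OF has_derivative_compose[OF snd B]]
    by (simp add: e_def)
  then have V1_rate:
    "?B (x2, q (x1, z)) = - \<sigma> * (norm (grad f x1))\<^sup>2 + lam * (grad f x1 \<bullet> e)"
    by (simp flip: B.add)
  have proj: "((\<lambda>p. (fst p, snd (snd p))) has_derivative (\<lambda>h. (fst h, snd (snd h)))) (at p)"
    by (auto intro!: derivative_eq_intros)
  have dA: "((\<lambda>p. \<alpha> (fst p, snd (snd p))) has_derivative (\<lambda>h. ?A (fst h, snd (snd h)))) (at p)"
    using has_derivative_compose[OF proj A] by (simp add: p)
  have dB: "((\<lambda>p. V1 (fst p, snd (snd p))) has_derivative (\<lambda>h. ?B (fst h, snd (snd h)))) (at p)"
    using has_derivative_compose[OF proj B] by (simp add: p)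
  define E where "E = (\<lambda>p. fst (snd p) - \<alpha> (fst p, snd (snd p)))"
  have dE: "(E has_derivative (\<lambda>h. fst (snd h) - ?A (fst h, snd (snd h)))) (at p)"
    unfolding E_def by (intro derivative_intros dA)
  have "((\<lambda>p. V1 (fst p, snd (snd p)) + E p \<bullet> E p / 2) has_derivative
      (\<lambda>h. ?B (fst h, snd (snd h)) + e \<bullet> (fst (snd h) - ?A (fst h, snd (snd h))))) (at p)"
    by (rule has_derivative_eq_rhs,
        rule has_derivative_add[OF dB bounded_linear.has_derivative[OF bounded_linear_divide
            has_derivative_inner[OF dE dE]]])
      (auto simp: E_def e_def p inner_commute)
  moreover have "composite_V V1 \<alpha> = (\<lambda>p. V1 (fst p, snd (snd p)) + E p \<bullet> E p / 2)"
    by (auto simp: composite_V_def E_def error_def power2_norm_eq_inner)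
  ultimately have dV: "(composite_V V1 \<alpha> has_derivative
      (\<lambda>h. ?B (fst h, snd (snd h)) + e \<bullet> (fst (snd h) - ?A (fst h, snd (snd h))))) (at p)"
    by simp
  have v: "v = (x2, alpha_dot \<alpha> q p - c *\<^sub>R e - lam *\<^sub>R grad f x1, q (x1, z))"
    by (simp add: v_def closed_loop_def feedback_def p error_def e_def)
  have rate: "?B (fst v, snd (snd v)) + e \<bullet> (fst (snd v) - ?A (fst v, snd (snd v)))
      = - \<sigma> * (norm (grad f x1))\<^sup>2 - c * (norm e)\<^sup>2"
    by (simp add: v alpha_dot V1_rate inner_diff_right inner_commute power2_norm_eq_inner)
  show "\<exists>V'. (composite_V V1 \<alpha> has_derivative V') (at p) \<and>
      V' (closed_loop f q \<alpha> lam c p) = (case p of (x1, x2, z) \<Rightarrow>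
        - \<sigma> * (norm (grad f x1))\<^sup>2 - c * (norm (error \<alpha> (x1, x2, z)))\<^sup>2)"
  proof (intro exI conjI)
    show "(composite_V V1 \<alpha> has_derivative
        (\<lambda>h. ?B (fst h, snd (snd h)) + e \<bullet> (fst (snd h) - ?A (fst h, snd (snd h))))) (at p)"
      by (rule dV)
  qed (use rate in \<open>simp add: v_def p error_def e_def\<close>)
qed

text \<open>
  The chain of bounds: \<open>V\<close> bounds \<open>gap f x1\<close>, \<open>z\<close> and the error, hence the gradient, hence \<open>\<alpha>\<close>,
  hence the velocity \<open>x2\<close>.  That makes the gradient Lipschitz in time.
\<close>

lemma closed_loop_grad_tendsto_zero:
  fixes f :: "'a::euclidean_space \<Rightarrow> real" and V1 :: "'a \<times> 'z::euclidean_space \<Rightarrow> real"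
  assumes f: "\<And>x. (f has_derivative f' x) (at x)"
    and smooth: "smooth_with L f" and bdd: "bdd_below (range f)"
    and pos: "c\<^sub>\<phi> > 0" "c\<^sub>z > 0" "\<sigma> > 0" "c > 0"
    and V1_lower: "\<And>x1 z. V1 (x1, z) \<ge> c\<^sub>\<phi> * gap f x1 + c\<^sub>z * (norm z)\<^sup>2"
    and \<alpha>_bounded: "\<And>R. R > 0 \<Longrightarrow>
      bounded (\<alpha> ` {(x1, z). norm (grad f x1) \<le> R \<and> norm z \<le> R})"
    and along: "derivative_along (composite_V V1 \<alpha>) (closed_loop f q \<alpha> lam c)
         (\<lambda>(x1, x2, z). - \<sigma> * (norm (grad f x1))\<^sup>2 - c * (norm (error \<alpha> (x1, x2, z)))\<^sup>2)"
    and sol: "solution_on {0..} (closed_loop f q \<alpha> lam c) (\<lambda>t. (x1 t, x2 t, z t))"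
  shows "((\<lambda>t. grad f (x1 t)) \<longlongrightarrow> 0) at_top"
proof -
  define e where "e t = x2 t - \<alpha> (x1 t, z t)" for t
  define W where "W t = V1 (x1 t, z t) + (norm (e t))\<^sup>2 / 2" for t
  define W' where "W' t = - \<sigma> * (norm (grad f (x1 t)))\<^sup>2 - c * (norm (e t))\<^sup>2" for t
  have deriv: "(W has_real_derivative W' t) (at t within {0..})" if "t \<ge> 0" for t
    using along[unfolded derivative_along_def, THEN conjunct2, rule_format, OF is_interval_ci sol, of t]
      that by (simp add: W_def[abs_def] W'_def e_def composite_V_def error_def)
  have W_antimono: "W t \<le> W 0" if "t \<ge> 0" for t
  proof -
    have "\<exists>\<xi>\<in>{0..t}. W t - W 0 = W' \<xi> * (t - 0)"
    proof (rule mvt_very_simple[OF that])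
      fix r assume "0 \<le> r" "r \<le> t"
      then have "(W has_real_derivative W' r) (at r within {0..t})"
        by (intro DERIV_subset[OF deriv]) auto
      then show "(W has_derivative (*) (W' r)) (at r within {0..t})"
        by (simp add: has_field_derivative_def)
    qed
    then obtain \<xi> where "W t - W 0 = W' \<xi> * t" by auto
    moreover have "W' \<xi> \<le> 0"
      unfolding W'_def using pos by (smt (verit) mult_nonneg_nonneg mult_minus_left zero_le_power2)
    ultimately show ?thesis using that mult_nonpos_nonneg[of "W' \<xi>" t] by linarith
  qed
  have gap_nonneg: "gap f x \<ge> 0" for x
    using bdd by (simp add: gap_def cINF_lower)
  have W_lower: "c\<^sub>\<phi> * gap f (x1 t) + c\<^sub>z * (norm (z t))\<^sup>2 + (norm (e t))\<^sup>2 / 2 \<le> W t" for t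
    using V1_lower[of "x1 t" "z t"] by (simp add: W_def)
  have terms_nonneg: "0 \<le> c\<^sub>\<phi> * gap f (x1 t)" "0 \<le> c\<^sub>z * (norm (z t))\<^sup>2" for t
    using pos gap_nonneg by simp_all
  have W_nonneg: "0 \<le> W t" for t
    using W_lower[of t] terms_nonneg[of t] zero_le_power2[of "norm (e t)"] by linarith
  have gap_bound: "gap f (x1 t) \<le> W 0 / c\<^sub>\<phi>" if "t \<ge> 0" for t
  proof -
    have "c\<^sub>\<phi> * gap f (x1 t) \<le> W 0"
      using W_lower[of t] terms_nonneg[of t] W_antimono[OF that] zero_le_power2[of "norm (e t)"]
      by linarith
    then show ?thesis using pos by (simp add: field_simps)
  qed
  have z_bound: "norm (z t) \<le> sqrt (W 0 / c\<^sub>z)" if "t \<ge> 0" for t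
  proof (rule real_le_rsqrt)
    have "c\<^sub>z * (norm (z t))\<^sup>2 \<le> W 0"
      using W_lower[of t] terms_nonneg[of t] W_antimono[OF that] zero_le_power2[of "norm (e t)"]
      by linarith
    then show "(norm (z t))\<^sup>2 \<le> W 0 / c\<^sub>z" using pos by (simp add: field_simps)
  qed
  have e_bound: "norm (e t) \<le> sqrt (2 * W 0)" if "t \<ge> 0" for t
    using W_lower[of t] terms_nonneg[of t] W_antimono[OF that] by (intro real_le_rsqrt) linarith
  (* A Lipschitz constant may be enlarged; a positive one can be divided by. *)
  define L' where "L' = max L 1"
  have "L' > 0" by (simp add: L'_def)
  have smooth': "smooth_with L' f"
    unfolding smooth_with_def
  proof (intro allI)
    fix x y
    have "norm (grad f x - grad f y) \<le> L * norm (x - y)" using smooth by (simp add: smooth_with_def)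
    also have "\<dots> \<le> L' * norm (x - y)" by (intro mult_right_mono) (auto simp: L'_def)
    finally show "norm (grad f x - grad f y) \<le> L' * norm (x - y)" .
  qed
  have grad_bound: "norm (grad f (x1 t)) \<le> sqrt (4 * L' * (W 0 / c\<^sub>\<phi>))" if "t \<ge> 0" for t
  proof (rule real_le_rsqrt)
    have "(norm (grad f (x1 t)))\<^sup>2 \<le> 4 * L' * gap f (x1 t)"
      by (rule grad_bound_by_gap[OF f smooth' \<open>L' > 0\<close> bdd])
    also have "\<dots> \<le> 4 * L' * (W 0 / c\<^sub>\<phi>)"
      using gap_bound[OF that] \<open>L' > 0\<close> by (intro mult_left_mono) auto
    finally show "(norm (grad f (x1 t)))\<^sup>2 \<le> 4 * L' * (W 0 / c\<^sub>\<phi>)" .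
  qed
  define R where "R = max 1 (max (sqrt (4 * L' * (W 0 / c\<^sub>\<phi>))) (sqrt (W 0 / c\<^sub>z)))"
  have "R > 0" by (simp add: R_def)
  obtain a where a: "\<And>y. y \<in> \<alpha> ` {(x1, z). norm (grad f x1) \<le> R \<and> norm z \<le> R} \<Longrightarrow> norm y \<le> a"
    using \<alpha>_bounded[OF \<open>R > 0\<close>] unfolding bounded_iff by blast
  have \<alpha>_bound: "norm (\<alpha> (x1 t, z t)) \<le> a" if "t \<ge> 0" for t
    using grad_bound[OF that] z_bound[OF that] by (intro a imageI) (simp add: R_def le_max_iff_disj)
  define M where "M = max 1 (sqrt (2 * W 0) + a)"
  have x2_bound: "norm (x2 t) \<le> M" if "t \<ge> 0" for t
  proof -
    have "norm (x2 t) \<le> norm (e t) + norm (\<alpha> (x1 t, z t))"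
      using norm_triangle_ineq[of "e t" "\<alpha> (x1 t, z t)"] by (simp add: e_def)
    then show ?thesis using e_bound[OF that] \<alpha>_bound[OF that] by (simp add: M_def)
  qed
  have x1_deriv: "(x1 has_vector_derivative x2 t) (at t within {0..})" if "t \<ge> 0" for t
  proof -
    have "((\<lambda>t. (x1 t, x2 t, z t)) has_vector_derivative
        closed_loop f q \<alpha> lam c (x1 t, x2 t, z t)) (at t within {0..})"
      using sol that by (simp add: solution_on_def)
    from bounded_linear.has_vector_derivative[OF bounded_linear_fst this]
    show ?thesis by (simp add: closed_loop_def)
  qed
  have x1_lip: "norm (x1 s - x1 t) \<le> M * norm (s - t)" if "s \<ge> 0" "t \<ge> 0" for s t
  proof (rule differentiable_bound)
    show "(x1 has_derivative (\<lambda>h. h *\<^sub>R x2 r)) (at r within {0..})" if "r \<in> {0..}" for r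
      using x1_deriv[of r] that by (simp add: has_vector_derivative_def)
    show "onorm (\<lambda>h. h *\<^sub>R x2 r) \<le> M" if "r \<in> {0..}" for r
      using x2_bound[of r] that by (intro onorm_le) (auto simp: mult.commute[of M] mult_left_mono)
  qed (use that in auto)
  show ?thesis
  proof (rule lipschitz_dissipation_imp_tendsto_zero[OF deriv _ \<open>\<sigma> > 0\<close> W_nonneg])
    show "W' t \<le> - \<sigma> * (norm (grad f (x1 t)))\<^sup>2" for t using pos by (simp add: W'_def)
    show "norm (grad f (x1 s) - grad f (x1 t)) \<le> (L' * M) * \<bar>s - t\<bar>" if "s \<ge> 0" "t \<ge> 0" for s t
    proof -
      have "norm (grad f (x1 s) - grad f (x1 t)) \<le> L' * norm (x1 s - x1 t)"
        using smooth' by (simp add: smooth_with_def)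
      also have "\<dots> \<le> L' * (M * norm (s - t))"
        using x1_lip[OF that] \<open>L' > 0\<close> by (intro mult_left_mono) auto
      finally show ?thesis by simp
    qed
    show "L' * M > 0" using \<open>L' > 0\<close> by (simp add: M_def)
  qed
qed

section \<open>The system without \<open>z\<close> as an invariant subspace\<close>

lemma closed_loop0_as_subsystem:
  fixes \<alpha> :: "'a::euclidean_space \<Rightarrow> 'a"
  shows "closed_loop f (\<lambda>_. 0) (\<lambda>p. \<alpha> (fst p)) lam c (fst p, snd p, 0 :: real)
    = (fst (closed_loop0 f \<alpha> lam c p), snd (closed_loop0 f \<alpha> lam c p), 0)"
  by (auto simp: closed_loop_def closed_loop0_def feedback_def feedback0_def error_def error0_def
      alpha_dot_def split: prod.split)

lemma composite_V0_as_restriction: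
  "composite_V (\<lambda>p. V1 (fst p) + (snd p)\<^sup>2) (\<lambda>p. \<alpha> (fst p)) (fst p, snd p, 0 :: real)
    = composite_V0 V1 \<alpha> p"
  by (auto simp: composite_V_def composite_V0_def error_def error0_def split: prod.split)

text \<open>
  A function of \<open>x1\<close> alone is turned into data for a scalar \<open>z\<close> with \<open>q = 0\<close>.  The summand
  \<open>z\<^sup>2\<close> of the enlarged \<open>V1\<close> supplies the lower bound in \<open>z\<close>; it is constant along trajectories
  and vanishes on \<open>z = 0\<close>.
\<close>

lemma closed_loop0_convergence:
  fixes f V1 :: "'a::euclidean_space \<Rightarrow> real"
  assumes f: "\<And>x. (f has_derivative f' x) (at x)"
    and smooth: "smooth_with L f" and bdd: "bdd_below (range f)"
    and pos: "c\<^sub>\<phi> > 0" "\<sigma> > 0" "c > 0"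
    and A: "\<And>y. (\<alpha> has_derivative A y) (at y)" and B: "\<And>y. (V1 has_derivative B y) (at y)"
    and V1_lower: "\<And>x1. V1 x1 \<ge> c\<^sub>\<phi> * gap f x1"
    and decay: "\<And>x1 e. grad V1 x1 \<bullet> (\<alpha> x1 + e)
        = - \<sigma> * (norm (grad f x1))\<^sup>2 + lam * (grad f x1 \<bullet> e)"
    and \<alpha>_bounded: "\<And>R. R > 0 \<Longrightarrow> bounded (\<alpha> ` {x1. norm (grad f x1) \<le> R})"
  shows "derivative_along (composite_V0 V1 \<alpha>) (closed_loop0 f \<alpha> lam c)
         (\<lambda>(x1, x2). - \<sigma> * (norm (grad f x1))\<^sup>2 - c * (norm (error0 \<alpha> (x1, x2)))\<^sup>2)" (is ?rate)
    and "solution_on {0..} (closed_loop0 f \<alpha> lam c) (\<lambda>t. (x1 t, x2 t)) \<Longrightarrow>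
      ((\<lambda>t. grad f (x1 t)) \<longlongrightarrow> 0) at_top"
proof -
  let ?q = "\<lambda>_ :: 'a \<times> real. 0 :: real"
  let ?\<alpha> = "\<lambda>p :: 'a \<times> real. \<alpha> (fst p)"
  let ?V1 = "\<lambda>p :: 'a \<times> real. V1 (fst p) + (snd p)\<^sup>2"
  let ?i = "\<lambda>p :: 'a \<times> 'a. (fst p, snd p, 0 :: real)"
  have fst: "(fst has_derivative fst) (at p)" for p :: "'a \<times> real"
    by (auto intro!: derivative_eq_intros)
  have A': "(?\<alpha> has_derivative (\<lambda>h. A (fst p) (fst h))) (at p)" for p
    by (rule has_derivative_compose[OF fst A])
  have B': "(?V1 has_derivative (\<lambda>h. B (fst p) (fst h) + 2 * snd p * snd h)) (at p)" for p
    by (rule has_derivative_eq_rhs, rule has_derivative_add[OF has_derivative_compose[OF fst B]])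
      (auto intro!: derivative_eq_intros)
  have decay': "grad (\<lambda>x. ?V1 (x, z)) x1 \<bullet> (?\<alpha> (x1, z) + e) + grad (\<lambda>w. ?V1 (x1, w)) z \<bullet> ?q (x1, z)
      = - \<sigma> * (norm (grad f x1))\<^sup>2 + lam * (grad f x1 \<bullet> e)" for x1 z e
  proof -
    have "((\<lambda>x. V1 x + z\<^sup>2) has_derivative B x1) (at x1)"
      by (rule has_derivative_eq_rhs, rule has_derivative_add[OF B has_derivative_const]) simp
    then have "grad (\<lambda>x. V1 x + z\<^sup>2) x1 \<bullet> h = grad V1 x1 \<bullet> h" for h
      by (simp add: inner_grad_eq_derivative[OF B] inner_grad_eq_derivative)
    then show ?thesis using decay[of x1 e] by simp
  qed
  note along = composite_V_derivative_along[OF A' B' decay', where c = c]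
  have "bounded_linear ?i"
    by (intro bounded_linear_Pair bounded_linear_fst bounded_linear_snd bounded_linear_zero)
  from derivative_along_pullback[where i = ?i and G = "closed_loop0 f \<alpha> lam c",
      OF along this closed_loop0_as_subsystem]
  show ?rate
    unfolding composite_V0_as_restriction by (simp add: error_def error0_def case_prod_beta')
  assume sol: "solution_on {0..} (closed_loop0 f \<alpha> lam c) (\<lambda>t. (x1 t, x2 t))"
  have sol': "solution_on {0..} (closed_loop f ?q ?\<alpha> lam c) (\<lambda>t. (x1 t, x2 t, 0))"
    unfolding solution_on_def
  proof
    fix t :: real assume "t \<in> {0..}"
    then have "((\<lambda>t. (x1 t, x2 t)) has_vector_derivative closed_loop0 f \<alpha> lam c (x1 t, x2 t))
        (at t within {0..})"
      using sol by (simp add: solution_on_def)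
    from bounded_linear.has_vector_derivative[OF \<open>bounded_linear ?i\<close> this]
    show "((\<lambda>t. (x1 t, x2 t, 0)) has_vector_derivative
        closed_loop f ?q ?\<alpha> lam c (x1 t, x2 t, 0)) (at t within {0..})"
      using closed_loop0_as_subsystem[of f \<alpha> lam c "(x1 t, x2 t)"] by simp
  qed
  have "bounded (?\<alpha> ` {(x1, z). norm (grad f x1) \<le> R \<and> norm z \<le> R})" if "R > 0" for R
    by (rule bounded_subset[OF \<alpha>_bounded[OF that]]) auto
  moreover have "?V1 (x1, z) \<ge> c\<^sub>\<phi> * gap f x1 + 1 * (norm z)\<^sup>2" for x1 z
    using V1_lower[of x1] by simp
  ultimately show "((\<lambda>t. grad f (x1 t)) \<longlongrightarrow> 0) at_top"
    using closed_loop_grad_tendsto_zero[OF f smooth bdd pos(1) zero_less_one pos(2,3) _ _ along sol']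
    by blast
qed

theorem theorem1:
  fixes f :: "real ^ 'n \<Rightarrow> real"
    and L \<sigma> lam c\<^sub>\<phi> c\<^sub>z c :: real
  assumes "twice_continuously_differentiable f"
    and "convex_on UNIV f"
    and "smooth_with L f"
    and "bdd_below (range f)"
    and "c\<^sub>\<phi> > 0" and "c\<^sub>z > 0" and "\<sigma> > 0" and "lam > 0" and "c > 0"
  shows
    "(\<forall>(q :: (real ^ 'n) \<times> (real ^ 'm) \<Rightarrow> real ^ 'm)
       (\<alpha> :: (real ^ 'n) \<times> (real ^ 'm) \<Rightarrow> real ^ 'n)
       (V1 :: (real ^ 'n) \<times> (real ^ 'm) \<Rightarrow> real).
       locally_lipschitz q \<longrightarrow>
       continuously_differentiable \<alpha> \<longrightarrow>
       continuously_differentiable V1 \<longrightarrow>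
       (\<forall>x1 z. V1 (x1, z) \<ge> c\<^sub>\<phi> * gap f x1 + c\<^sub>z * (norm z)\<^sup>2) \<longrightarrow>
       (\<forall>x1 z e.
          grad (\<lambda>x. V1 (x, z)) x1 \<bullet> (\<alpha> (x1, z) + e) + grad (\<lambda>w. V1 (x1, w)) z \<bullet> q (x1, z)
            = - \<sigma> * (norm (grad f x1))\<^sup>2 + lam * (grad f x1 \<bullet> e)) \<longrightarrow>
       (\<forall>R>0. bounded (\<alpha> ` {(x1, z). norm (grad f x1) \<le> R \<and> norm z \<le> R})) \<longrightarrow>
       derivative_along (composite_V V1 \<alpha>) (closed_loop f q \<alpha> lam c)
         (\<lambda>(x1, x2, z). - \<sigma> * (norm (grad f x1))\<^sup>2 - c * (norm (error \<alpha> (x1, x2, z)))\<^sup>2) \<and>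
       (\<forall>x1 x2 z. solution_on {0..} (closed_loop f q \<alpha> lam c) (\<lambda>t. (x1 t, x2 t, z t)) \<longrightarrow>
          ((\<lambda>t. grad f (x1 t)) \<longlongrightarrow> 0) at_top))
   \<and>
     (\<forall>(\<alpha> :: real ^ 'n \<Rightarrow> real ^ 'n) (V1 :: real ^ 'n \<Rightarrow> real).
       continuously_differentiable \<alpha> \<longrightarrow>
       continuously_differentiable V1 \<longrightarrow>
       (\<forall>x1. V1 x1 \<ge> c\<^sub>\<phi> * gap f x1) \<longrightarrow>
       (\<forall>x1 e. grad V1 x1 \<bullet> (\<alpha> x1 + e)
            = - \<sigma> * (norm (grad f x1))\<^sup>2 + lam * (grad f x1 \<bullet> e)) \<longrightarrow>
       (\<forall>R>0. bounded (\<alpha> ` {x1. norm (grad f x1) \<le> R})) \<longrightarrow>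
       derivative_along (composite_V0 V1 \<alpha>) (closed_loop0 f \<alpha> lam c)
         (\<lambda>(x1, x2). - \<sigma> * (norm (grad f x1))\<^sup>2 - c * (norm (error0 \<alpha> (x1, x2)))\<^sup>2) \<and>
       (\<forall>x1 x2. solution_on {0..} (closed_loop0 f \<alpha> lam c) (\<lambda>t. (x1 t, x2 t)) \<longrightarrow>
          ((\<lambda>t. grad f (x1 t)) \<longlongrightarrow> 0) at_top))"
proof -
  obtain Df :: "real ^ 'n \<Rightarrow> (real ^ 'n) \<Rightarrow>\<^sub>L real"
    where f': "\<And>x. (f has_derivative blinfun_apply (Df x)) (at x)"
    using assms(1) unfolding twice_continuously_differentiable_def by blast
  show ?thesis
  proof (intro conjI allI impI, goal_cases)
    case (1 q \<alpha> V1)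
    obtain A B where "\<And>y. (\<alpha> has_derivative A y) (at y)" "\<And>y. (V1 has_derivative B y) (at y)"
      using 1 by (metis continuously_differentiableE)
    then show ?case using 1 by (intro composite_V_derivative_along) auto
  next
    case (2 q \<alpha> V1 x1 x2 z)
    obtain A B where "\<And>y. (\<alpha> has_derivative A y) (at y)" "\<And>y. (V1 has_derivative B y) (at y)"
      using 2 by (metis continuously_differentiableE)
    then have "derivative_along (composite_V V1 \<alpha>) (closed_loop f q \<alpha> lam c)
        (\<lambda>(x1, x2, z). - \<sigma> * (norm (grad f x1))\<^sup>2 - c * (norm (error \<alpha> (x1, x2, z)))\<^sup>2)"
      using 2 by (intro composite_V_derivative_along) auto
    from closed_loop_grad_tendsto_zero[OF f' assms(3-7,9) _ _ this] 2
    show ?case by blast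
  next
    case (3 \<alpha> V1)
    obtain A B where "\<And>y. (\<alpha> has_derivative A y) (at y)" "\<And>y. (V1 has_derivative B y) (at y)"
      using 3 by (metis continuously_differentiableE)
    from closed_loop0_convergence(1)[OF f' assms(3-5,7,9) this] 3
    show ?case by blast
  next
    case (4 \<alpha> V1 x1 x2)
    obtain A B where "\<And>y. (\<alpha> has_derivative A y) (at y)" "\<And>y. (V1 has_derivative B y) (at y)"
      using 4 by (metis continuously_differentiableE)
    from closed_loop0_convergence(2)[OF f' assms(3-5,7,9) this] 4
    show ?case by blast
  qed
qed

end
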